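(* Any random utility model $q:\mathbb R^n\to\Delta_{n-1}$ is a substitutable choice model.
   Context: $\mathcal N=\{1,\dots,n\}$; $\Delta_{n-1}=\{x\in\mathbb R^n\mid\sum_i x_i=1,\ x\ge0\}$. Random utility model: given an absolutely continuous joint distribution $\theta$ of $\epsilon=(\epsilon_1,\dots,\epsilon_n)$ on $\mathbb R^n$, the choice probabilities are $q_i(\mu)=\mathbb P_{\epsilon\sim\theta}\big(i=\arg\max_{k\in\mathcal N}(\mu_k+\epsilon_k)\big)$ for $\mu\in\mathbb R^n$, $i\in\mathcal N$. A function $f:\mathbb R\to\mathbb R$ is locally decreasing at $x$ if there exists $\delta>0$ such that $f(x-h)\ge f(x)\ge f(x+h)$ for all $0<h<\delta$. For a choice model $q:\mathbb R^n\to\Delta_{n-1}$, alternative $i$ is substitutable to alternative $j$ if for every $\mu\in\mathbb R^n$, $q_j$ is locally decreasing in $\mu_i$ at $\mu$ (the other coordinates of $\mu$ being fixed). The choice model $q$ is a substitutable choice model if for all $i\ne j$ in $\mathcal N$, alternative $i$ is substitutable to alternative $j$. *)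

theory Defs
  imports "HOL-Probability.Probability"
begin

definition prob_simplex :: "(real ^ 'n) set" where
  "prob_simplex = {x. (\<Sum>i\<in>UNIV. x $ i) = 1 \<and> (\<forall>i. 0 \<le> x $ i)}"

(* The event "i = argmax" is read as: i is the one and only maximiser.  Ties form a
   Lebesgue null set, so for absolutely continuous distributions any tie-breaking
   convention gives the same probabilities. *)
definition choice_prob :: "(real ^ 'n) measure \<Rightarrow> real ^ 'n \<Rightarrow> real ^ 'n" where
  "choice_prob \<theta> \<mu> =
     (\<chi> i. measure \<theta> {\<epsilon>. {k. is_arg_max (\<lambda>k. \<mu> $ k + \<epsilon> $ k) (\<lambda>k. k \<in> UNIV) k} = {i}})"

definition random_utility_model :: "(real ^ 'n \<Rightarrow> real ^ 'n) \<Rightarrow> bool" where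
  "random_utility_model q \<longleftrightarrow>
     (\<exists>\<theta>. prob_space \<theta> \<and> sets \<theta> = sets borel \<and> absolutely_continuous lborel \<theta> \<and>
          q = choice_prob \<theta>)"

definition choice_model :: "(real ^ 'n \<Rightarrow> real ^ 'n) \<Rightarrow> bool" where
  "choice_model q \<longleftrightarrow> q \<in> UNIV \<rightarrow> prob_simplex"

definition locally_decreasing_at :: "(real \<Rightarrow> real) \<Rightarrow> real \<Rightarrow> bool" where
  "locally_decreasing_at f x \<longleftrightarrow>
     (\<exists>\<delta>>0. \<forall>h. 0 < h \<and> h < \<delta> \<longrightarrow> f (x - h) \<ge> f x \<and> f x \<ge> f (x + h))"

definition substitutable_to :: "(real ^ 'n \<Rightarrow> real ^ 'n) \<Rightarrow> 'n \<Rightarrow> 'n \<Rightarrow> bool" where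
  "substitutable_to q i j \<longleftrightarrow>
     (\<forall>\<mu>. locally_decreasing_at (\<lambda>t. q (\<chi> k. if k = i then t else \<mu> $ k) $ j) (\<mu> $ i))"

definition substitutable_choice_model :: "(real ^ 'n \<Rightarrow> real ^ 'n) \<Rightarrow> bool" where
  "substitutable_choice_model q \<longleftrightarrow>
     choice_model q \<and> (\<forall>i j. i \<noteq> j \<longrightarrow> substitutable_to q i j)"

end

theory Submission
  imports Defs
begin

text \<open>
  Alternative \<open>j\<close> is the unique maximiser of \<open>k \<mapsto> \<mu>\<^sub>k + \<epsilon>\<^sub>k\<close> exactly when \<open>\<epsilon>\<close> lies in the set
  where \<open>\<mu>\<^sub>k + \<epsilon>\<^sub>k < \<mu>\<^sub>j + \<epsilon>\<^sub>j\<close> for all \<open>k \<noteq> j\<close>. Raising \<open>\<mu>\<^sub>i\<close> for a single \<open>i \<noteq> j\<close> can only shrink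
  this set, so the probability of choosing \<open>j\<close> is globally, hence locally, decreasing in \<open>\<mu>\<^sub>i\<close>.

  That the choice probabilities sum to one is where absolute continuity enters: the sets
  belonging to different alternatives are disjoint, and a point outside all of them lies on one
  of the finitely many hyperplanes \<open>\<mu>\<^sub>i + \<epsilon>\<^sub>i = \<mu>\<^sub>j + \<epsilon>\<^sub>j\<close> with \<open>i \<noteq> j\<close>, which are Lebesgue null.
\<close>

text \<open>The noise vectors for which \<open>i\<close> has strictly larger utility than every other alternative.\<close>

definition win_set :: "real ^ 'n \<Rightarrow> 'n \<Rightarrow> (real ^ 'n) set" where
  "win_set \<mu> i = {\<epsilon>. \<forall>k. k \<noteq> i \<longrightarrow> \<mu> $ k + \<epsilon> $ k < \<mu> $ i + \<epsilon> $ i}"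

lemma unique_arg_max_iff:
  fixes f :: "'a \<Rightarrow> real"
  shows "{k. is_arg_max f (\<lambda>k. k \<in> UNIV) k} = {i} \<longleftrightarrow> (\<forall>k. k \<noteq> i \<longrightarrow> f k < f i)"
proof
  assume unique: "{k. is_arg_max f (\<lambda>k. k \<in> UNIV) k} = {i}"
  then have "is_arg_max f (\<lambda>k. k \<in> UNIV) i"
    by blast
  then have max: "f k \<le> f i" for k
    by (simp add: is_arg_max_def not_less)
  show "\<forall>k. k \<noteq> i \<longrightarrow> f k < f i"
  proof (intro allI impI)
    fix k assume "k \<noteq> i"
    with unique have "\<not> is_arg_max f (\<lambda>k. k \<in> UNIV) k"
      by blast
    then obtain l where "f k < f l"
      by (auto simp: is_arg_max_def)
    with max[of l] show "f k < f i"
      by simp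
  qed
next
  assume *: "\<forall>k. k \<noteq> i \<longrightarrow> f k < f i"
  then have "f k \<le> f i" for k
    by (cases "k = i") (auto intro: less_imp_le)
  then have "is_arg_max f (\<lambda>k. k \<in> UNIV) i"
    by (simp add: is_arg_max_def not_less)
  moreover have "\<not> is_arg_max f (\<lambda>k. k \<in> UNIV) k" if "k \<noteq> i" for k
    using * that by (auto simp: is_arg_max_def)
  ultimately show "{k. is_arg_max f (\<lambda>k. k \<in> UNIV) k} = {i}"
    by blast
qed

lemma choice_prob_eq_measure_win_set: "choice_prob \<theta> \<mu> $ i = measure \<theta> (win_set \<mu> i)"
  unfolding choice_prob_def win_set_def unique_arg_max_iff by simp

lemma borel_win_set: "win_set \<mu> i \<in> sets borel"
proof -
  have "win_set \<mu> i = (\<Inter>k\<in>UNIV - {i}. {\<epsilon>. \<mu> $ k + \<epsilon> $ k < \<mu> $ i + \<epsilon> $ i})"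
    by (auto simp: win_set_def)
  also have "open \<dots>"
    by (intro open_INT ballI open_Collect_less continuous_intros) auto
  finally show ?thesis
    by simp
qed

lemma disjoint_win_set: "disjoint_family (win_set \<mu>)"
  unfolding disjoint_family_on_def
proof (intro ballI impI)
  fix i j :: 'a assume "i \<noteq> j"
  have False if "\<epsilon> \<in> win_set \<mu> i" "\<epsilon> \<in> win_set \<mu> j" for \<epsilon>
  proof -
    have "\<mu> $ j + \<epsilon> $ j < \<mu> $ i + \<epsilon> $ i" "\<mu> $ i + \<epsilon> $ i < \<mu> $ j + \<epsilon> $ j"
      using that \<open>i \<noteq> j\<close> by (simp_all add: win_set_def)
    then show False
      by simp
  qed
  then show "win_set \<mu> i \<inter> win_set \<mu> j = {}"
    by blast
qed

lemma tie_null_set: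
  fixes \<mu> :: "real ^ 'n"
  assumes "i \<noteq> j"
  shows "{\<epsilon>. \<mu> $ i + \<epsilon> $ i = \<mu> $ j + \<epsilon> $ j} \<in> null_sets lborel"
proof -
  define a :: "real ^ 'n" where "a = axis i 1 - axis j 1"
  have "a $ i = 1"
    using assms by (simp add: a_def axis_def)
  then have "a \<noteq> 0"
    by auto
  moreover have eq: "{\<epsilon>. \<mu> $ i + \<epsilon> $ i = \<mu> $ j + \<epsilon> $ j} = {\<epsilon>. a \<bullet> \<epsilon> = \<mu> $ j - \<mu> $ i}"
    by (auto simp: a_def inner_diff_left inner_axis')
  ultimately have "{\<epsilon>. \<mu> $ i + \<epsilon> $ i = \<mu> $ j + \<epsilon> $ j} \<in> null_sets lebesgue"
    by (simp add: negligible_hyperplane flip: negligible_iff_null_sets)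
  moreover have "{\<epsilon>. \<mu> $ i + \<epsilon> $ i = \<mu> $ j + \<epsilon> $ j} \<in> sets borel"
    unfolding eq by (intro borel_closed closed_hyperplane)
  ultimately show ?thesis
    by (auto simp: null_sets_def)
qed

lemma Compl_win_sets_subset_ties:
  fixes \<mu> :: "real ^ 'n"
  shows "- (\<Union>i. win_set \<mu> i) \<subseteq>
    (\<Union>(i, j)\<in>{(i, j). i \<noteq> j}. {\<epsilon>. \<mu> $ i + \<epsilon> $ i = \<mu> $ j + \<epsilon> $ j})"
proof
  fix \<epsilon> assume outside: "\<epsilon> \<in> - (\<Union>i. win_set \<mu> i)"
  let ?f = "\<lambda>k. \<mu> $ k + \<epsilon> $ k"
  have "Max (range ?f) \<in> range ?f"
    by (intro Max_in) auto
  then obtain i where i: "Max (range ?f) = ?f i"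
    by (rule rangeE)
  have max: "?f k \<le> ?f i" for k
    unfolding i[symmetric] by (rule Max_ge) auto
  from outside obtain j where "j \<noteq> i" "\<not> ?f j < ?f i"
    by (auto simp: win_set_def)
  with max[of j] have "?f i = ?f j"
    by simp
  with \<open>j \<noteq> i\<close> show "\<epsilon> \<in> (\<Union>(i, j)\<in>{(i, j). i \<noteq> j}. {\<epsilon>. \<mu> $ i + \<epsilon> $ i = \<mu> $ j + \<epsilon> $ j})"
    by blast
qed

lemma sum_choice_prob:
  fixes \<theta> :: "(real ^ 'n) measure"
  assumes "prob_space \<theta>" and sets: "sets \<theta> = sets borel"
    and ac: "absolutely_continuous lborel \<theta>"
  shows "(\<Sum>i\<in>UNIV. choice_prob \<theta> \<mu> $ i) = 1"
proof -
  interpret prob_space \<theta> by fact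
  have "(\<Union>(i, j)\<in>{(i, j). i \<noteq> j}. {\<epsilon>. \<mu> $ i + \<epsilon> $ i = \<mu> $ j + \<epsilon> $ j}) \<in> null_sets \<theta>"
  proof (rule null_sets_UN')
    show "countable {(i, j). i \<noteq> (j :: 'n)}"
      by (intro countable_finite) simp
  qed (use ac tie_null_set in \<open>auto simp: absolutely_continuous_def\<close>)
  then have "AE \<epsilon> in \<theta>. \<epsilon> \<in> (\<Union>i. win_set \<mu> i)"
    by (rule AE_I') (use Compl_win_sets_subset_ties[of \<mu>] in blast)
  moreover have "(\<Union>i. win_set \<mu> i) \<in> sets \<theta>"
    using borel_win_set by (auto simp: sets)
  ultimately have "prob (\<Union>i. win_set \<mu> i) = 1"
    using prob_eq_1 by blast
  also have "prob (\<Union>i. win_set \<mu> i) = (\<Sum>i\<in>UNIV. prob (win_set \<mu> i))"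
    using borel_win_set disjoint_win_set
    by (intro finite_measure_finite_Union) (auto simp: sets)
  finally show ?thesis
    by (simp add: choice_prob_eq_measure_win_set)
qed

lemma choice_prob_antimono:
  fixes \<theta> :: "(real ^ 'n) measure"
  assumes "prob_space \<theta>" and sets: "sets \<theta> = sets borel" and "i \<noteq> j" and "s \<le> t"
  shows "choice_prob \<theta> (\<chi> k. if k = i then t else \<mu> $ k) $ j
    \<le> choice_prob \<theta> (\<chi> k. if k = i then s else \<mu> $ k) $ j"
proof -
  interpret prob_space \<theta> by fact
  have "win_set (\<chi> k. if k = i then t else \<mu> $ k) j \<subseteq> win_set (\<chi> k. if k = i then s else \<mu> $ k) j"
  proof
    fix \<epsilon> assume win: "\<epsilon> \<in> win_set (\<chi> k. if k = i then t else \<mu> $ k) j"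
    show "\<epsilon> \<in> win_set (\<chi> k. if k = i then s else \<mu> $ k) j"
      unfolding win_set_def mem_Collect_eq
    proof (intro allI impI)
      fix k assume "k \<noteq> j"
      with win have "(if k = i then t else \<mu> $ k) + \<epsilon> $ k < \<mu> $ j + \<epsilon> $ j"
        using \<open>i \<noteq> j\<close> by (simp add: win_set_def)
      then show "(\<chi> k. if k = i then s else \<mu> $ k) $ k + \<epsilon> $ k
          < (\<chi> k. if k = i then s else \<mu> $ k) $ j + \<epsilon> $ j"
        using \<open>i \<noteq> j\<close> \<open>s \<le> t\<close> by (simp split: if_splits)
    qed
  qed
  then show ?thesis
    unfolding choice_prob_eq_measure_win_set
    by (rule finite_measure_mono) (simp add: sets borel_win_set)
qed

theorem theorem5:
  fixes q :: "real ^ 'n \<Rightarrow> real ^ 'n"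
  assumes "random_utility_model q"
  shows "substitutable_choice_model q"
proof -
  obtain \<theta> where \<theta>: "prob_space \<theta>" "sets \<theta> = sets borel" "absolutely_continuous lborel \<theta>"
    and q: "q = choice_prob \<theta>"
    using assms by (auto simp: random_utility_model_def)
  have "choice_model q"
    using sum_choice_prob[OF \<theta>]
    by (auto simp: choice_model_def prob_simplex_def q choice_prob_eq_measure_win_set)
  moreover have "substitutable_to q i j" if "i \<noteq> j" for i j
    unfolding substitutable_to_def locally_decreasing_at_def q
    \<comment> \<open>The monotonicity is global, so any positive \<open>\<delta>\<close> will do.\<close>
    by (intro allI exI[of _ 1] conjI impI choice_prob_antimono \<theta> that) auto
  ultimately show ?thesis
    by (simp add: substitutable_choice_model_def)
qed

end
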